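(* Let $q\in(0,1)$, $\alpha\in[0,1]$ and let $k\ge2$ be an integer. Then: (i) $\displaystyle\lim_{n\to\infty}a_{n,q}(r,k)=q^{r(r-1)/2}(1-q)^{k-r}S_q(k,r)$ for $r=0,1,\ldots,k$; (ii) $\displaystyle\lim_{n\to\infty}\lambda_{k,q}^{(\alpha,n)}=q^{k(k-1)/2}$.
   Context: For $q>0$: $[0]_q=0$, $[m]_q=1+q+\cdots+q^{m-1}$ for $m\ge1$; $[0]_q!=1$, $[m]_q!=[1]_q[2]_q\cdots[m]_q$; $\left[{m\atop k}\right]_q=\frac{[m]_q!}{[k]_q!\,[m-k]_q!}$ for $0\le k\le m$. The $q$-Stirling numbers of the second kind are $S_q(k,r)=\frac{1}{[r]_q!\,q^{r(r-1)/2}}\sum_{i=0}^r(-1)^iq^{i(i-1)/2}\left[{r\atop i}\right]_q[r-i]_q^k$ (with $0^0=1$); in particular $S_q(0,0)=1$, $S_q(k,0)=0$ for $k>0$, $S_q(k,r)=0$ for $k<r$. For $n\ge k\ge2$ and $0\le r\le k$ (these are the coefficients of $x^r$ in the image of $t^k$ under the $(\alpha,q)$-Bernstein operator of order $n$), $$a_{n,q}(r,k)=\frac{q^{r(r-1)/2}[n-2]_q!}{[n]_q^k[n-r]_q!}\Big\{(1-\alpha)[n-r]_q\big([n+r-1]_qS_q(k+1,r+1)-[r+1]_q[n-1]_qS_q(k,r+1)\big)+\alpha[n]_q[n-1]_qS_q(k,r)\Big\},$$ where for $r=0,1$ the factor $[n-2]_q!/[n-r]_q!$ is simply the quotient of these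 $q$-factorials. Further, $$\lambda_{k,q}^{(\alpha,n)}=\frac{q^{k(k-1)/2}[n-2]_q!}{[n-k]_q![n]_q^k}\Big((1-\alpha)[n-k]_q[n-1+k]_q+\alpha[n]_q[n-1]_q\Big),\qquad 2\le k\le n.$$ *)

theory Defs
  imports Complex_Main
begin

definition q_int :: "real \<Rightarrow> nat \<Rightarrow> real" where
  "q_int q m = (\<Sum>i<m. q ^ i)"

definition q_fact :: "real \<Rightarrow> nat \<Rightarrow> real" where
  "q_fact q m = (\<Prod>j=1..m. q_int q j)"

(* Outside 0 \<le> k \<le> m, where the quotient formula is not meant to apply (and m - k would
   truncate), the coefficient is set to 0; that case is not used below. *)
definition q_binomial :: "real \<Rightarrow> nat \<Rightarrow> nat \<Rightarrow> real" where
  "q_binomial q m k =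
     (if k \<le> m then q_fact q m / (q_fact q k * q_fact q (m - k)) else 0)"

(* The exponents r(r-1)/2 and i(i-1)/2 are computed in nat: the division is exact, and truncated
   subtraction is harmless since 0 * (0 - 1) = 0. The convention 0^0 = 1 is that of (^). *)
definition q_stirling2 :: "real \<Rightarrow> nat \<Rightarrow> nat \<Rightarrow> real" where
  "q_stirling2 q k r =
     1 / (q_fact q r * q ^ (r * (r - 1) div 2)) *
     (\<Sum>i=0..r. (-1) ^ i * q ^ (i * (i - 1) div 2) * q_binomial q r i * q_int q (r - i) ^ k)"

(* The coefficient of x^r in the image of t^k under the (alpha,q)-Bernstein operator of order n.
   Meaningful for n \<ge> k \<ge> 2 and r \<le> k; no subtraction truncates in that range. *)
definition bernstein_coeff :: "real \<Rightarrow> real \<Rightarrow> nat \<Rightarrow> nat \<Rightarrow> nat \<Rightarrow> real" where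
  "bernstein_coeff \<alpha> q n r k =
     q ^ (r * (r - 1) div 2) * q_fact q (n - 2) / (q_int q n ^ k * q_fact q (n - r)) *
     ((1 - \<alpha>) * q_int q (n - r) *
        (q_int q (n + r - 1) * q_stirling2 q (k + 1) (r + 1)
         - q_int q (r + 1) * q_int q (n - 1) * q_stirling2 q k (r + 1))
      + \<alpha> * q_int q n * q_int q (n - 1) * q_stirling2 q k r)"

(* The number lambda_{k,q}^{(alpha,n)}, meaningful for 2 \<le> k \<le> n. *)
definition bernstein_lambda :: "real \<Rightarrow> real \<Rightarrow> nat \<Rightarrow> nat \<Rightarrow> real" where
  "bernstein_lambda \<alpha> q n k =
     q ^ (k * (k - 1) div 2) * q_fact q (n - 2) / (q_fact q (n - k) * q_int q n ^ k) *
     ((1 - \<alpha>) * q_int q (n - k) * q_int q (n - 1 + k) + \<alpha> * q_int q n * q_int q (n - 1))"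

end

theory Submission
  imports Defs
begin

text \<open>
  Put \<open>L = 1 / (1 - q)\<close>. For \<open>0 < q < 1\<close> the \<open>q\<close>-integer \<open>[m]\<close> is a partial sum of the
  geometric series, so \<open>[n - j]\<close> and \<open>[n + j]\<close> tend to \<open>L\<close> for every fixed
  \<open>j\<close>. Because \<open>[n]! / [n - r]!\<close> is a product of \<open>r\<close> such factors, it tends to \<open>L\<^sup>r\<close>, and hence
  \<open>[n - 2]! / [n - r]!\<close> tends to \<open>L\<^sup>r / L\<^sup>2\<close>; passing through \<open>[n]!\<close> treats \<open>r = 0, 1\<close>
  in the same way as \<open>r \<ge> 2\<close>.

  In the limit the braces of the coefficient become
  \<open>L\<^sup>2 ((1 - \<alpha>) (S(k+1, r+1) - [r+1] S(k, r+1)) + \<alpha> S(k, r))\<close>. The triangular recurrence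
  \<open>S(k+1, r+1) = S(k, r) + [r+1] S(k, r+1)\<close> (lemma \<open>q_stirling2_Suc_Suc\<close>) collapses this to
  \<open>L\<^sup>2 S(k, r)\<close>, so that \<open>\<alpha>\<close> disappears. Together with \<open>[n]\<^sup>k \<longlonglongrightarrow> L\<^sup>k\<close> there remains
  \<open>L\<^sup>r / L\<^sup>k = (1 - q)\<^bsup>k - r\<^esup>\<close>. For \<open>\<lambda>\<close> the powers of \<open>L\<close> cancel completely.
\<close>

lemma q_int_pos: "0 < q \<Longrightarrow> 0 < m \<Longrightarrow> 0 < q_int q m"
  unfolding q_int_def by (rule sum_pos) auto

lemma q_fact_pos: "0 < q \<Longrightarrow> 0 < q_fact q m"
  unfolding q_fact_def by (rule prod_pos) (auto intro: q_int_pos)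

lemma q_fact_Suc: "q_fact q (Suc m) = q_int q (Suc m) * q_fact q m"
  by (simp add: q_fact_def mult.commute)

lemma q_int_add: "q_int q (a + b) = q_int q a + q ^ a * q_int q b"
  unfolding q_int_def by (induction b) (simp_all add: power_add algebra_simps)

lemma q_binomial_absorption:
  assumes "0 < q" "j \<le> r"
  shows "q_binomial q (Suc r) (Suc j) * q_int q (Suc j) = q_int q (Suc r) * q_binomial q r j"
  using assms q_int_pos[of q "Suc j"] by (simp add: q_binomial_def q_fact_Suc)

lemma triangular_Suc: "Suc j * j div 2 = j * (j - 1) div 2 + j"
  by (cases j) (simp_all add: algebra_simps)

text \<open>
  In \<open>S(k+1, r+1) - [r+1] S(k, r+1)\<close> the \<open>i\<close>-th summands combine to a multiple of
  \<open>[r+1-i] - [r+1] = - q\<^bsup>r+1-i\<^esup> [i]\<close>. The term \<open>i = 0\<close> drops out, and absorbing \<open>[i]\<close> into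
  the \<open>q\<close>-binomial coefficient turns the remaining terms, shifted by one, into
  those of \<open>S(k, r)\<close>.
\<close>
lemma q_stirling2_Suc_Suc:
  assumes q: "0 < q"
  shows "q_stirling2 q (Suc k) (Suc r) = q_stirling2 q k r + q_int q (Suc r) * q_stirling2 q k (Suc r)"
proof -
  define f where "f = (\<lambda>r i. (-1) ^ i * q ^ (i * (i - 1) div 2) * q_binomial q r i)"
  have S: "q_stirling2 q k r =
      1 / (q_fact q r * q ^ (r * (r - 1) div 2)) * (\<Sum>i=0..r. f r i * q_int q (r - i) ^ k)" for k r
    by (simp add: q_stirling2_def f_def)
  have shift: "f (Suc r) (Suc j) * q_int q (r - j) ^ k * (q_int q (r - j) - q_int q (Suc r))
        = q ^ r * q_int q (Suc r) * (f r j * q_int q (r - j) ^ k)" if "j \<le> r" for j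
  proof -
    have diff: "q_int q (r - j) - q_int q (Suc r) = - (q ^ (r - j) * q_int q (Suc j))"
      using q_int_add[of q "r - j" "Suc j"] that by simp
    have pow: "q ^ (Suc j * j div 2) * q ^ (r - j) = q ^ r * q ^ (j * (j - 1) div 2)"
      using that unfolding triangular_Suc power_add[symmetric] by (simp add: add.commute)
    have "f (Suc r) (Suc j) * q_int q (r - j) ^ k * (q_int q (r - j) - q_int q (Suc r))
        = (-1) ^ j * (q ^ (Suc j * j div 2) * q ^ (r - j))
            * (q_binomial q (Suc r) (Suc j) * q_int q (Suc j)) * q_int q (r - j) ^ k"
      unfolding diff f_def by (simp del: mult_Suc)
    also have "\<dots> = q ^ r * q_int q (Suc r) * (f r j * q_int q (r - j) ^ k)"
      unfolding pow q_binomial_absorption[OF q that] f_def by (simp add: ac_simps)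
    finally show ?thesis .
  qed
  have "(\<Sum>i=0..Suc r. f (Suc r) i * q_int q (Suc r - i) ^ Suc k)
          - q_int q (Suc r) * (\<Sum>i=0..Suc r. f (Suc r) i * q_int q (Suc r - i) ^ k)
      = (\<Sum>i=0..Suc r. f (Suc r) i * q_int q (Suc r - i) ^ k
                        * (q_int q (Suc r - i) - q_int q (Suc r)))"
    by (simp only: sum_distrib_left sum_subtractf[symmetric]) (simp add: algebra_simps)
  also have "\<dots> = (\<Sum>j=0..r. f (Suc r) (Suc j) * q_int q (r - j) ^ k
                        * (q_int q (r - j) - q_int q (Suc r)))"
    by (subst sum.atLeast0_atMost_Suc_shift) simp
  also have "\<dots> = (\<Sum>j=0..r. q ^ r * q_int q (Suc r) * (f r j * q_int q (r - j) ^ k))"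
    by (rule sum.cong) (auto simp: shift)
  also have "\<dots> = q ^ r * q_int q (Suc r) * (\<Sum>j=0..r. f r j * q_int q (r - j) ^ k)"
    by (simp only: sum_distrib_left)
  finally have sums: "(\<Sum>i=0..Suc r. f (Suc r) i * q_int q (Suc r - i) ^ Suc k)
      = q ^ r * q_int q (Suc r) * (\<Sum>j=0..r. f r j * q_int q (r - j) ^ k)
        + q_int q (Suc r) * (\<Sum>i=0..Suc r. f (Suc r) i * q_int q (Suc r - i) ^ k)"
    by simp
  have denom: "q_fact q (Suc r) * q ^ (Suc r * (Suc r - 1) div 2)
      = q ^ r * q_int q (Suc r) * (q_fact q r * q ^ (r * (r - 1) div 2))"
    unfolding diff_Suc_1 triangular_Suc q_fact_Suc by (simp add: power_add ac_simps)
  show ?thesis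
    unfolding S sums denom
    using q q_int_pos[of q "Suc r"] q_fact_pos[of q r] by (simp add: divide_simps algebra_simps del: sum.cl_ivl_Suc)
qed

lemma tendsto_q_int:
  assumes "0 < q" "q < 1" "filterlim g at_top sequentially"
  shows "(\<lambda>n. q_int q (g n)) \<longlonglongrightarrow> 1 / (1 - q)"
proof -
  have "q_int q \<longlonglongrightarrow> 1 / (1 - q)"
    using geometric_sums[of q] assms unfolding sums_def q_int_def by simp
  then show ?thesis
    using assms(3) by (rule filterlim_compose)
qed

lemma tendsto_q_fact_div_q_fact_diff:
  assumes q: "0 < q" "q < 1"
  shows "(\<lambda>n. q_fact q n / q_fact q (n - r)) \<longlonglongrightarrow> (1 / (1 - q)) ^ r"
proof (induction r)
  case 0
  show ?case using q_fact_pos[OF q(1)] by (simp add: less_imp_neq[symmetric])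
next
  case (Suc r)
  have eq: "q_fact q n / q_fact q (n - Suc r)
      = q_int q (n - r) * (q_fact q n / q_fact q (n - r))" if "n > r" for n
  proof -
    have "n - r = Suc (n - Suc r)" using that by simp
    then have "q_fact q (n - r) = q_int q (n - r) * q_fact q (n - Suc r)"
      by (simp only: q_fact_Suc)
    then show ?thesis
      using q_int_pos[OF q(1), of "n - r"] that by simp
  qed
  have "(\<lambda>n. q_int q (n - r) * (q_fact q n / q_fact q (n - r)))
      \<longlonglongrightarrow> 1 / (1 - q) * (1 / (1 - q)) ^ r"
    by (intro tendsto_mult Suc tendsto_q_int q filterlim_minus_const_nat_at_top)
  then show ?case
    unfolding power_Suc
    by (rule Lim_transform_eventually)
      (use eventually_gt_at_top[of r] in eventually_elim, simp add: eq)
qed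

lemma tendsto_q_fact_diff_div_q_fact_diff:
  assumes q: "0 < q" "q < 1"
  shows "(\<lambda>n. q_fact q (n - s) / q_fact q (n - r)) \<longlonglongrightarrow> (1 / (1 - q)) ^ r / (1 / (1 - q)) ^ s"
proof -
  have "(\<lambda>n. (q_fact q n / q_fact q (n - r)) / (q_fact q n / q_fact q (n - s)))
      \<longlonglongrightarrow> (1 / (1 - q)) ^ r / (1 / (1 - q)) ^ s"
    using q by (intro tendsto_divide tendsto_q_fact_div_q_fact_diff) auto
  moreover have "(q_fact q n / q_fact q (n - r)) / (q_fact q n / q_fact q (n - s))
      = q_fact q (n - s) / q_fact q (n - r)" for n
    using q_fact_pos[OF q(1), of n] by simp
  ultimately show ?thesis by simp
qed

theorem lemma4p3:
  fixes q \<alpha> :: real and k :: nat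
  assumes "0 < q" "q < 1" and "0 \<le> \<alpha>" "\<alpha> \<le> 1" and "2 \<le> k"
  shows "(\<forall>r\<le>k. (\<lambda>n. bernstein_coeff \<alpha> q n r k)
                    \<longlonglongrightarrow> q ^ (r * (r - 1) div 2) * (1 - q) ^ (k - r) * q_stirling2 q k r)
       \<and> (\<lambda>n. bernstein_lambda \<alpha> q n k) \<longlonglongrightarrow> q ^ (k * (k - 1) div 2)"
proof (intro conjI allI impI)
  note q = assms(1,2)
  define L where "L = 1 / (1 - q)"
  have L: "L \<noteq> 0" and L': "1 - q = 1 / L"
    using q by (auto simp: L_def)
  have id: "q_int q \<longlonglongrightarrow> L"
    unfolding L_def by (intro tendsto_q_int q filterlim_ident)
  have diff: "(\<lambda>n. q_int q (n - c)) \<longlonglongrightarrow> L" for c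
    unfolding L_def by (intro tendsto_q_int q filterlim_minus_const_nat_at_top)
  have add_diff: "(\<lambda>n. q_int q (n + c - 1)) \<longlonglongrightarrow> L" for c
    unfolding L_def
    by (intro tendsto_q_int q filterlim_compose[OF filterlim_minus_const_nat_at_top]
        filterlim_add_const_nat_at_top)
  have diff_add: "(\<lambda>n. q_int q (n - 1 + c)) \<longlonglongrightarrow> L" for c
    unfolding L_def
    by (intro tendsto_q_int q filterlim_compose[OF filterlim_add_const_nat_at_top]
        filterlim_minus_const_nat_at_top)
  have ratio: "(\<lambda>n. q_fact q (n - 2) / q_fact q (n - r)) \<longlonglongrightarrow> L ^ r / L ^ 2" for r
    unfolding L_def by (rule tendsto_q_fact_diff_div_q_fact_diff[OF q])
  {
    fix r assume r: "r \<le> k"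
    let ?Q = "q ^ (r * (r - 1) div 2)" and ?S = "q_stirling2 q"
    have "(\<lambda>n. ?Q * (q_fact q (n - 2) / q_fact q (n - r)) / q_int q n ^ k *
        ((1 - \<alpha>) * q_int q (n - r) *
           (q_int q (n + r - 1) * ?S (k + 1) (r + 1)
            - q_int q (r + 1) * q_int q (n - 1) * ?S k (r + 1))
         + \<alpha> * q_int q n * q_int q (n - 1) * ?S k r))
      \<longlonglongrightarrow> ?Q * (L ^ r / L ^ 2) / L ^ k *
        ((1 - \<alpha>) * L * (L * ?S (k + 1) (r + 1) - q_int q (r + 1) * L * ?S k (r + 1))
         + \<alpha> * L * L * ?S k r)"
      using L by (intro tendsto_intros id diff add_diff ratio) auto
    also have "?Q * (L ^ r / L ^ 2) / L ^ k *
        ((1 - \<alpha>) * L * (L * ?S (k + 1) (r + 1) - q_int q (r + 1) * L * ?S k (r + 1))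
         + \<alpha> * L * L * ?S k r)
      = ?Q * (L ^ r / L ^ k) * ?S k r"
      using L q_stirling2_Suc_Suc[OF q(1), of k r]
      by (simp add: field_simps power2_eq_square)
    also have "L ^ r / L ^ k = (1 - q) ^ (k - r)"
      using L r by (simp add: L' power_diff field_simps)
    finally show "(\<lambda>n. bernstein_coeff \<alpha> q n r k) \<longlonglongrightarrow> ?Q * (1 - q) ^ (k - r) * ?S k r"
      by (simp add: bernstein_coeff_def mult.commute)
  }
  let ?Q = "q ^ (k * (k - 1) div 2)"
  have "(\<lambda>n. ?Q * (q_fact q (n - 2) / q_fact q (n - k)) / q_int q n ^ k *
      ((1 - \<alpha>) * q_int q (n - k) * q_int q (n - 1 + k) + \<alpha> * q_int q n * q_int q (n - 1)))
    \<longlonglongrightarrow> ?Q * (L ^ k / L ^ 2) / L ^ k * ((1 - \<alpha>) * L * L + \<alpha> * L * L)"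
    using L by (intro tendsto_intros id diff diff_add ratio) auto
  also have "?Q * (L ^ k / L ^ 2) / L ^ k * ((1 - \<alpha>) * L * L + \<alpha> * L * L) = ?Q"
    using L by (simp add: field_simps power2_eq_square)
  finally show "(\<lambda>n. bernstein_lambda \<alpha> q n k) \<longlonglongrightarrow> ?Q"
    by (simp add: bernstein_lambda_def)
qed

end
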